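(* For $m\ge2$, let $Q_{4m}=\langle a,b\mid a^{2m}=e,\ b^2=a^m,\ b^{-1}ab=a^{-1}\rangle$ be the generalized quaternion group of order $4m$. In the directed Cayley graph $\Gamma(Q_{4m},\{a,b\})$ the Lin--Lu--Yau Ricci curvatures of the arcs $(e,a)$ and $(e,b)$ are $$\kappa(e,a)=\begin{cases}0,& m=2,\\ -\tfrac12,& m=3,\\ -1,& m=4,\\ -\tfrac32,& m=5,\\ -2,& m\ge6,\end{cases}\qquad \kappa(e,b)=\begin{cases}0,& m=2,\\ -\tfrac12,& m=3,\\ -1,& m\ge4.\end{cases}$$
   Context: For a group $G$ with identity $e$ and a finite set $S\subseteq G\setminus\{e\}$, the directed Cayley graph $\Gamma(G,S)$ has vertex set $G$ and arcs $(g,gs)$ for $g\in G$, $s\in S$. In a simple directed graph $(V,\mathcal A)$, $N^{\rm out}(x)=\{v\in V:(x,v)\in\mathcal A\}$, $d^{\rm out}_x=|N^{\rm out}(x)|$, and $d(x,y)$ is the length of a shortest directed path from $x$ to $y$. For $\alpha\in[0,1]$, the $\alpha$-lazy random walk measure at $x$ is $\mu^\alpha_x(x)=\alpha$, $\mu^\alpha_x(v)=\frac{1-\alpha}{d^{\rm out}_x}$ if $(x,v)\in\mathcal A$, and $\mu_x^\alpha(v)=0$ otherwise. For probability measures $\mu,\nu$ on $V$, $W(\mu,\nu)=\inf_A\sum_{u,v\in V}A(u,v)d(u,v)$, the infimum over couplings $A:V\times V\to[0,1]$ with $\sum_{v}A(u,v)=\mu(u)$ for all $u$ and $\sum_uA(u,v)=\nu(v)$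 for all $v$. For distinct $x,y$, $\kappa_\alpha(x,y)=1-\frac{W(\mu_x^\alpha,\mu_y^\alpha)}{d(x,y)}$, and the Lin--Lu--Yau Ricci curvature is $\kappa(x,y)=\lim_{\alpha\to1^-}\frac{\kappa_\alpha(x,y)}{1-\alpha}$. *)

theory Defs
  imports "HOL-Analysis.Analysis" "HOL-Algebra.Group"
begin

section \<open>Groups given by generators and relations\<close>

text \<open>A letter \<open>(x, False)\<close> stands for the generator \<open>x\<close> and \<open>(x, True)\<close> for its formal inverse.
  A relation \<open>u = v\<close> is the pair of words \<open>(u, v)\<close>.\<close>

type_synonym 'g word = "('g \<times> bool) list"

inductive pres_eq :: "('g word \<times> 'g word) set \<Rightarrow> 'g word \<Rightarrow> 'g word \<Rightarrow> bool"
  for R :: "('g word \<times> 'g word) set" where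
  refl: "pres_eq R u u"
| sym: "pres_eq R u v \<Longrightarrow> pres_eq R v u"
| trans: "pres_eq R u v \<Longrightarrow> pres_eq R v w \<Longrightarrow> pres_eq R u w"
| append: "pres_eq R u u' \<Longrightarrow> pres_eq R v v' \<Longrightarrow> pres_eq R (u @ v) (u' @ v')"
| cancel: "pres_eq R [(x, s), (x, \<not> s)] []"
| relation: "(u, v) \<in> R \<Longrightarrow> pres_eq R u v"

definition pres_class :: "('g word \<times> 'g word) set \<Rightarrow> 'g word \<Rightarrow> 'g word set" where
  "pres_class R u = {v. pres_eq R u v}"

definition presented_group :: "('g word \<times> 'g word) set \<Rightarrow> 'g word set monoid" where
  "presented_group R =
     \<lparr>carrier = range (pres_class R),
      mult = (\<lambda>X Y. {w. \<exists>u\<in>X. \<exists>v\<in>Y. pres_eq R (u @ v) w}),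
      one = pres_class R []\<rparr>"

lemma pres_class_eq_iff: "pres_class R u = pres_class R v \<longleftrightarrow> pres_eq R u v"
  unfolding pres_class_def by (blast intro: pres_eq.intros)

lemma mult_pres_class:
  "pres_class R u \<otimes>\<^bsub>presented_group R\<^esub> pres_class R v = pres_class R (u @ v)"
  unfolding pres_class_def presented_group_def monoid.simps
  by (blast intro: pres_eq.intros)

lemma pres_eq_inverse: "pres_eq R (rev (map (\<lambda>(x, s). (x, \<not> s)) u) @ u) []"
proof (induction u)
  case Nil
  show ?case by (simp add: pres_eq.refl)
next
  case (Cons p u)
  obtain x s where p: "p = (x, s)" by (cases p)
  let ?v = "rev (map (\<lambda>(x, s). (x, \<not> s)) u)"
  have "pres_eq R [(x, \<not> s), (x, s)] []"
    using pres_eq.cancel[of R x "\<not> s"] by simp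
  then have "pres_eq R (?v @ [(x, \<not> s), (x, s)] @ u) (?v @ [] @ u)"
    by (intro pres_eq.append pres_eq.refl)
  with Cons show ?case by (auto simp: p intro: pres_eq.trans)
qed

lemma group_presented_group: "group (presented_group R)"
proof (rule groupI)
  let ?G = "presented_group R"
  have car: "carrier ?G = range (pres_class R)" and one: "\<one>\<^bsub>?G\<^esub> = pres_class R []"
    by (simp_all add: presented_group_def)
  show "\<one>\<^bsub>?G\<^esub> \<in> carrier ?G" by (simp add: car one)
  fix x assume x: "x \<in> carrier ?G"
  then obtain u where u: "x = pres_class R u" by (auto simp: car)
  show "\<one>\<^bsub>?G\<^esub> \<otimes>\<^bsub>?G\<^esub> x = x" by (simp add: u one mult_pres_class)
  show "\<exists>y\<in>carrier ?G. y \<otimes>\<^bsub>?G\<^esub> x = \<one>\<^bsub>?G\<^esub>"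
    using pres_eq_inverse[of R u]
    by (auto simp: u one car mult_pres_class pres_class_eq_iff)
  fix y assume y: "y \<in> carrier ?G"
  show "x \<otimes>\<^bsub>?G\<^esub> y \<in> carrier ?G"
    using x y by (auto simp: car mult_pres_class)
  fix z assume z: "z \<in> carrier ?G"
  show "x \<otimes>\<^bsub>?G\<^esub> y \<otimes>\<^bsub>?G\<^esub> z = x \<otimes>\<^bsub>?G\<^esub> (y \<otimes>\<^bsub>?G\<^esub> z)"
    using x y z by (auto simp: car mult_pres_class)
qed

section \<open>The generalized quaternion group\<close>

datatype quat_gen = GenA | GenB

definition quat_relations :: "nat \<Rightarrow> (quat_gen word \<times> quat_gen word) set" where
  "quat_relations m =
     {(replicate (2 * m) (GenA, False), []),
      ([(GenB, False), (GenB, False)], replicate m (GenA, False)),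
      ([(GenB, True), (GenA, False), (GenB, False)], [(GenA, True)])}"

definition gen_quaternion :: "nat \<Rightarrow> quat_gen word set monoid" where
  "gen_quaternion m = presented_group (quat_relations m)"

definition quat_a :: "nat \<Rightarrow> quat_gen word set" where
  "quat_a m = pres_class (quat_relations m) [(GenA, False)]"

definition quat_b :: "nat \<Rightarrow> quat_gen word set" where
  "quat_b m = pres_class (quat_relations m) [(GenB, False)]"

section \<open>Directed graphs and Lin--Lu--Yau curvature\<close>

text \<open>A simple directed graph is given by its vertex set \<open>V\<close> and its arc set \<open>E \<subseteq> V \<times> V\<close>.\<close>

definition cayley_arcs :: "('a, 'b) monoid_scheme \<Rightarrow> 'a set \<Rightarrow> ('a \<times> 'a) set" where
  "cayley_arcs G S = {(g, g \<otimes>\<^bsub>G\<^esub> s) | g s. g \<in> carrier G \<and> s \<in> S}"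

definition out_nbrs :: "('a \<times> 'a) set \<Rightarrow> 'a \<Rightarrow> 'a set" where
  "out_nbrs E x = {v. (x, v) \<in> E}"

text \<open>The distance is only meaningful if \<open>y\<close> is reachable from \<open>x\<close>; in a Cayley graph of a finite
  group with respect to a generating set this is always the case.  A shortest directed walk is a
  path, so it suffices to minimize over walks.\<close>

definition digraph_dist :: "('a \<times> 'a) set \<Rightarrow> 'a \<Rightarrow> 'a \<Rightarrow> nat" where
  "digraph_dist E x y = (LEAST n. (x, y) \<in> E ^^ n)"

definition lazy_measure :: "('a \<times> 'a) set \<Rightarrow> real \<Rightarrow> 'a \<Rightarrow> 'a \<Rightarrow> real" where
  "lazy_measure E \<alpha> x v =
     (if v = x then \<alpha>
      else if (x, v) \<in> E then (1 - \<alpha>) / real (card (out_nbrs E x))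
      else 0)"

definition couplings :: "'a set \<Rightarrow> ('a \<Rightarrow> real) \<Rightarrow> ('a \<Rightarrow> real) \<Rightarrow> ('a \<Rightarrow> 'a \<Rightarrow> real) set" where
  "couplings V \<mu> \<nu> =
     {A. (\<forall>u\<in>V. \<forall>v\<in>V. 0 \<le> A u v \<and> A u v \<le> 1) \<and>
         (\<forall>u\<in>V. ((\<lambda>v. A u v) has_sum \<mu> u) V) \<and>
         (\<forall>v\<in>V. ((\<lambda>u. A u v) has_sum \<nu> v) V)}"

text \<open>For measures of finite support, such as the lazy random walk measures of a graph with finite
  out-degrees, couplings have finite support, so the sum below is summable and the infimum is over a
  nonempty set that is bounded below.\<close>

definition wasserstein :: "'a set \<Rightarrow> ('a \<times> 'a) set \<Rightarrow> ('a \<Rightarrow> real) \<Rightarrow> ('a \<Rightarrow> real) \<Rightarrow> real" where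
  "wasserstein V E \<mu> \<nu> =
     (INF A\<in>couplings V \<mu> \<nu>. \<Sum>\<^sub>\<infinity>(u, v)\<in>V \<times> V. A u v * real (digraph_dist E u v))"

definition lazy_curvature :: "'a set \<Rightarrow> ('a \<times> 'a) set \<Rightarrow> real \<Rightarrow> 'a \<Rightarrow> 'a \<Rightarrow> real" where
  "lazy_curvature V E \<alpha> x y =
     1 - wasserstein V E (lazy_measure E \<alpha> x) (lazy_measure E \<alpha> y) / real (digraph_dist E x y)"

text \<open>The curvature \<open>\<kappa>(x, y)\<close> exists and equals \<open>k\<close>.\<close>

definition has_LLY_curvature :: "'a set \<Rightarrow> ('a \<times> 'a) set \<Rightarrow> 'a \<Rightarrow> 'a \<Rightarrow> real \<Rightarrow> bool" where
  "has_LLY_curvature V E x y k \<longleftrightarrow>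
     ((\<lambda>\<alpha>. lazy_curvature V E \<alpha> x y / (1 - \<alpha>)) \<longlongrightarrow> k) (at_left 1)"

end

theory Submission
  imports Defs
begin

text \<open>For \<open>{x, y} = {a, b}\<close>, transporting \<open>e\<close> to \<open>x\<close>, \<open>x\<close> to \<open>x y\<close> and \<open>y\<close> to \<open>x\<^sup>2\<close> costs
  \<open>\<alpha> + (1 - \<alpha>) / 2 * (n + 1)\<close> with \<open>n = d(y, x\<^sup>2)\<close>, so that \<open>\<kappa>(e, x) \<ge> (1 - n) / 2\<close>.  Equality is
  certified by the potential \<open>g \<mapsto> d(g, {x a, x b}) - 1\<close>, which drops by at most 1 along each arc.
  In the quaternion group \<open>n\<close> is \<open>min (m - 1) 5\<close> for \<open>x = a\<close> and \<open>min (m - 1) 3\<close> for \<open>x = b\<close>.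
  The upper bounds on \<open>n\<close> are explicit walks; the lower bounds hold because the group acts on its
  normal forms \<open>a\<^sup>i b\<^sup>s\<close>, on which the potential is given by a formula.  It is not needed
  that the normal forms exhaust the group.\<close>

section \<open>Optimal transport along a bijection\<close>

lemma has_sum_only_at:
  fixes c :: real
  assumes "a \<in> V" "\<And>v. v \<in> V \<Longrightarrow> v \<noteq> a \<Longrightarrow> g v = 0" "g a = c"
  shows "(g has_sum c) V"
proof -
  have "(g has_sum c) V \<longleftrightarrow> (g has_sum c) {a}"
    by (rule has_sum_cong_neutral) (use assms in auto)
  then show ?thesis
    using assms has_sum_finite[of "{a}" g] by simp
qed

lemma has_sum_finite_support:
  fixes g :: "'a \<Rightarrow> real"
  assumes "(g has_sum c) V" "S \<subseteq> V" "finite S" "\<And>v. v \<in> V - S \<Longrightarrow> g v = 0"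
  shows "sum g S = c"
proof -
  have "(g has_sum c) V \<longleftrightarrow> (g has_sum c) S"
    by (rule has_sum_cong_neutral) (use assms in auto)
  with assms show ?thesis
    using has_sum_finite[of S g] has_sum_unique by blast
qed

text \<open>Kantorovich duality with an explicit optimal pair. Every coupling costs at least the sum
  of \<open>A u v * (f u - f v)\<close>, which depends on the marginals alone, and moving all mass
  along \<open>\<sigma>\<close> attains this bound.\<close>

lemma wasserstein_bij:
  fixes f \<mu> \<nu> :: "'a \<Rightarrow> real"
  assumes "finite S" "S \<subseteq> V" "T \<subseteq> V" and bij: "bij_betw \<sigma> S T"
    and \<mu>: "\<And>u. u \<in> S \<Longrightarrow> 0 \<le> \<mu> u \<and> \<mu> u \<le> 1" and \<mu>0: "\<And>u. u \<in> V - S \<Longrightarrow> \<mu> u = 0"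
    and \<nu>: "\<And>u. u \<in> S \<Longrightarrow> \<nu> (\<sigma> u) = \<mu> u" and \<nu>0: "\<And>v. v \<in> V - T \<Longrightarrow> \<nu> v = 0"
    and lip: "\<And>u v. u \<in> S \<Longrightarrow> v \<in> T \<Longrightarrow> f u - f v \<le> real (digraph_dist E u v)"
    and tight: "\<And>u. u \<in> S \<Longrightarrow> real (digraph_dist E u (\<sigma> u)) = f u - f (\<sigma> u)"
  shows "wasserstein V E \<mu> \<nu> = (\<Sum>u\<in>S. \<mu> u * (f u - f (\<sigma> u)))"
proof -
  let ?d = "\<lambda>u v. real (digraph_dist E u v)"
  let ?cost = "\<lambda>A. \<Sum>\<^sub>\<infinity>(u, v)\<in>V \<times> V. A u v * ?d u v"
  have finT: "finite T" and T: "T = \<sigma> ` S" and inj: "inj_on \<sigma> S"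
    using bij \<open>finite S\<close> by (auto simp: bij_betw_def)
  have cost: "?cost A = (\<Sum>u\<in>S. \<Sum>v\<in>T. A u v * ?d u v)"
    and row: "\<And>u. u \<in> S \<Longrightarrow> (\<Sum>v\<in>T. A u v) = \<mu> u"
    and col: "\<And>v. v \<in> T \<Longrightarrow> (\<Sum>u\<in>S. A u v) = \<nu> v"
    and nonneg: "\<And>u v. u \<in> S \<Longrightarrow> v \<in> T \<Longrightarrow> 0 \<le> A u v"
    if A: "A \<in> couplings V \<mu> \<nu>" for A
  proof -
    have r: "((\<lambda>v. A u v) has_sum \<mu> u) V" and c: "((\<lambda>v. A v u) has_sum \<nu> u) V" if "u \<in> V" for u
      using A that by (auto simp: couplings_def)
    have pos: "0 \<le> A u v" if "u \<in> V" "v \<in> V" for u v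
      using A that by (auto simp: couplings_def)
    \<comment> \<open>A nonnegative family with sum 0 vanishes, so a coupling lives on
      \<open>S \<times> T\<close> and its infinite sums become finite ones.\<close>
    have z1: "A u v = 0" if "u \<in> V - S" "v \<in> V" for u v
      using nonneg_has_sum_le_0D[OF r, of u v] \<mu>0[of u] pos[of u] that by auto
    have z2: "A u v = 0" if "v \<in> V - T" "u \<in> V" for u v
      using nonneg_has_sum_le_0D[OF c, of v u] \<nu>0[of v] pos[of _ v] that by auto
    have "?cost A = (\<Sum>\<^sub>\<infinity>(u, v)\<in>S \<times> T. A u v * ?d u v)"
    proof (rule infsum_cong_neutral)
      fix p assume "p \<in> V \<times> V - S \<times> T"
      then obtain u v where "p = (u, v)" "u \<in> V" "v \<in> V" "u \<notin> S \<or> v \<notin> T" by blast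
      then show "(case p of (u, v) \<Rightarrow> A u v * ?d u v) = 0"
        using z1[of u v] z2[of v u] by auto
    qed (use \<open>S \<subseteq> V\<close> \<open>T \<subseteq> V\<close> in auto)
    then show "?cost A = (\<Sum>u\<in>S. \<Sum>v\<in>T. A u v * ?d u v)"
      using \<open>finite S\<close> finT by (simp add: sum.cartesian_product)
    show "(\<Sum>v\<in>T. A u v) = \<mu> u" if "u \<in> S" for u
      using has_sum_finite_support[OF r] z2 that \<open>S \<subseteq> V\<close> \<open>T \<subseteq> V\<close> finT by blast
    show "(\<Sum>u\<in>S. A u v) = \<nu> v" if "v \<in> T" for v
      using has_sum_finite_support[OF c] z1 that \<open>S \<subseteq> V\<close> \<open>T \<subseteq> V\<close> \<open>finite S\<close> by blast
    show "0 \<le> A u v" if "u \<in> S" "v \<in> T" for u v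
      using pos that \<open>S \<subseteq> V\<close> \<open>T \<subseteq> V\<close> by blast
  qed
  let ?W = "\<Sum>u\<in>S. \<mu> u * (f u - f (\<sigma> u))"
  \<comment> \<open>Splitting the difference leaves one sum over rows and one over columns, both
    fixed by the marginals.\<close>
  have dual: "(\<Sum>u\<in>S. \<Sum>v\<in>T. A u v * (f u - f v)) = ?W" if A: "A \<in> couplings V \<mu> \<nu>" for A
  proof -
    have "(\<Sum>u\<in>S. \<Sum>v\<in>T. A u v * (f u - f v))
        = (\<Sum>u\<in>S. \<Sum>v\<in>T. A u v * f u) - (\<Sum>u\<in>S. \<Sum>v\<in>T. A u v * f v)"
      by (simp add: right_diff_distrib sum_subtractf)
    also have "(\<Sum>u\<in>S. \<Sum>v\<in>T. A u v * f u) = (\<Sum>u\<in>S. \<mu> u * f u)"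
      by (rule sum.cong[OF HOL.refl]) (simp add: row[OF A] flip: sum_distrib_right)
    also have "(\<Sum>u\<in>S. \<Sum>v\<in>T. A u v * f v) = (\<Sum>v\<in>T. \<Sum>u\<in>S. A u v * f v)"
      by (rule sum.swap)
    also have "\<dots> = (\<Sum>v\<in>T. \<nu> v * f v)"
      by (rule sum.cong[OF HOL.refl]) (simp add: col[OF A] flip: sum_distrib_right)
    also have "\<dots> = (\<Sum>u\<in>S. \<mu> u * f (\<sigma> u))"
      unfolding T using \<nu> by (simp add: sum.reindex[OF inj])
    finally show ?thesis
      by (simp add: right_diff_distrib sum_subtractf)
  qed
  have lower: "?W \<le> ?cost A" if A: "A \<in> couplings V \<mu> \<nu>" for A
    unfolding cost[OF A] dual[OF A, symmetric]
    by (intro sum_mono mult_left_mono lip nonneg[OF A])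
  \<comment> \<open>The coupling carried by the graph of \<open>\<sigma>\<close>; on its support the
    distance equals the drop of \<open>f\<close>.\<close>
  define A where "A u v = (if u \<in> S \<and> v = \<sigma> u then \<mu> u else 0)" for u v
  have A: "A \<in> couplings V \<mu> \<nu>"
  proof -
    have "((\<lambda>v. A u v) has_sum \<mu> u) V" if "u \<in> V" for u
    proof (cases "u \<in> S")
      case True
      then show ?thesis
        by (intro has_sum_only_at[of "\<sigma> u"]) (use T \<open>T \<subseteq> V\<close> in \<open>auto simp: A_def\<close>)
    next
      case False
      then show ?thesis using \<mu>0 that by (auto simp: A_def intro!: has_sum_0)
    qed
    moreover have "((\<lambda>u. A u v) has_sum \<nu> v) V" if "v \<in> V" for v
    proof (cases "v \<in> T")
      case True
      then obtain u where u: "u \<in> S" "v = \<sigma> u" using T by auto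
      then show ?thesis
        by (intro has_sum_only_at[of u])
          (use \<nu> inj \<open>S \<subseteq> V\<close> in \<open>auto simp: A_def dest: inj_onD\<close>)
    next
      case False
      then have "A u v = 0" for u using T by (auto simp: A_def)
      then show ?thesis using \<nu>0 that False by (auto intro!: has_sum_0)
    qed
    moreover have "0 \<le> A u v \<and> A u v \<le> 1" for u v
      using \<mu> by (simp add: A_def)
    ultimately show ?thesis by (simp add: couplings_def)
  qed
  have "?cost A = ?W"
    unfolding cost[OF A] dual[OF A, symmetric]
    by (intro sum.cong HOL.refl) (auto simp: A_def tight)
  then have "?W \<in> ?cost ` couplings V \<mu> \<nu>" using A by force
  then show ?thesis
    unfolding wasserstein_def by (rule cInf_eq_minimum) (use lower in auto)
qed

section \<open>Distances and curvature in Cayley graphs\<close>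

lemma digraph_dist_le: "(x, y) \<in> E ^^ n \<Longrightarrow> digraph_dist E x y \<le> n"
  unfolding digraph_dist_def by (rule Least_le)

text \<open>Along a walk of length \<open>n\<close> the value of \<open>f\<close> falls by at most
  \<open>n\<close>. Reachability makes the \<open>LEAST\<close> in the distance the length of an
  actual walk.\<close>

lemma digraph_dist_ge:
  fixes f :: "'a \<Rightarrow> real"
  assumes "(x, y) \<in> E\<^sup>*" and f: "\<And>u v. (u, v) \<in> E \<Longrightarrow> f u \<le> f v + 1"
  shows "f x - f y \<le> real (digraph_dist E x y)"
proof -
  have walk: "f x - f y \<le> real n" if "(x, y) \<in> E ^^ n" for n
    using that
  proof (induction n arbitrary: y)
    case (Suc n)
    then obtain z where "(x, z) \<in> E ^^ n" "(z, y) \<in> E" by auto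
    with Suc.IH[of z] f[of z y] show ?case by simp
  qed simp
  obtain n where "(x, y) \<in> E ^^ n" using assms(1) rtrancl_imp_relpow by blast
  then have "(x, y) \<in> E ^^ digraph_dist E x y"
    unfolding digraph_dist_def by (rule LeastI)
  then show ?thesis by (rule walk)
qed

lemma out_nbrs_cayley_arcs:
  "g \<in> carrier G \<Longrightarrow> out_nbrs (cayley_arcs G S) g = (\<lambda>s. g \<otimes>\<^bsub>G\<^esub> s) ` S"
  by (auto simp: out_nbrs_def cayley_arcs_def)

lemma (in group) cayley_step:
  "g \<in> carrier G \<Longrightarrow> s \<in> S \<Longrightarrow> (g, g \<otimes> s) \<in> cayley_arcs G S"
  by (auto simp: cayley_arcs_def)

lemma (in group) cayley_walk_power:
  assumes "g \<in> carrier G" "s \<in> S" "s \<in> carrier G"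
  shows "(g, g \<otimes> s [^] (n::nat)) \<in> cayley_arcs G S ^^ n"
proof (induction n)
  case (Suc n)
  have "(g \<otimes> s [^] n, g \<otimes> s [^] n \<otimes> s) \<in> cayley_arcs G S"
    using assms by (intro cayley_step) auto
  with Suc show ?case using assms by (auto simp: m_assoc)
qed (use assms in simp)

text \<open>The transport moves \<open>\<one>\<close> to \<open>x\<close>, \<open>x\<close> to \<open>x \<otimes> y\<close> and \<open>y\<close> to \<open>x \<otimes> x\<close>, for every laziness;
  \<open>f\<close> is the Kantorovich potential certifying its optimality.\<close>

lemma (in group) LLY_curvature_two_generators:
  fixes f :: "'a \<Rightarrow> real" and n :: nat
  assumes x: "x \<in> carrier G" and y: "y \<in> carrier G"
    and "x \<noteq> \<one>" "y \<noteq> \<one>" "x \<noteq> y" and S: "S = {x, y}"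
    and f: "\<And>u v. (u, v) \<in> cayley_arcs G S \<Longrightarrow> f u \<le> f v + 1"
    and f_vals: "f \<one> = 1" "f x = 0" "f (x \<otimes> x) = - 1" "f (x \<otimes> y) = - 1" "f y = real n - 1"
    and walk: "(y, x \<otimes> x) \<in> cayley_arcs G S ^^ n"
    and loop: "(x \<otimes> x, x) \<in> (cayley_arcs G S)\<^sup>*"
  shows "has_LLY_curvature (carrier G) (cayley_arcs G S) \<one> x ((1 - real n) / 2)"
proof -
  let ?V = "carrier G" and ?E = "cayley_arcs G S"
  let ?d = "\<lambda>u v. real (digraph_dist ?E u v)"
  let ?S = "{\<one>, x, y}" and ?T = "{x, x \<otimes> y, x \<otimes> x}"
  have step: "(g, g \<otimes> x) \<in> ?E" "(g, g \<otimes> y) \<in> ?E" if "g \<in> ?V" for g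
    using that S by (auto intro: cayley_step)
  have arcs: "(\<one>, x) \<in> ?E" "(\<one>, y) \<in> ?E" "(x, x \<otimes> x) \<in> ?E" "(x, x \<otimes> y) \<in> ?E"
    using step[of \<one>] step[of x] x y by auto
  \<comment> \<open>Every source reaches \<open>x\<close> and \<open>x\<close> reaches every target,
    so all distances between \<open>?S\<close> and \<open>?T\<close> are lengths of walks.\<close>
  have "(y, x) \<in> ?E\<^sup>*"
    using relpow_imp_rtrancl[OF walk] loop by (rule rtrancl_trans)
  then have "(u, x) \<in> ?E\<^sup>*" if "u \<in> ?S" for u
    using that arcs(1) by blast
  moreover have "(x, v) \<in> ?E\<^sup>*" if "v \<in> ?T" for v
    using that arcs(3,4) by blast
  ultimately have reach: "(u, v) \<in> ?E\<^sup>*" if "u \<in> ?S" "v \<in> ?T" for u v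
    using that by (meson rtrancl_trans)
  have lip: "f u - f v \<le> ?d u v" if "u \<in> ?S" "v \<in> ?T" for u v
    using digraph_dist_ge[OF reach[OF that]] f by blast
  have d1: "?d u v = 1" if "(u, v) \<in> ?E" "f u - f v = 1" "u \<in> ?S" "v \<in> ?T" for u v
    using lip[OF that(3,4)] that(1,2) digraph_dist_le[of u v 1 ?E] by simp
  have dx: "?d \<one> x = 1" and dxy: "?d x (x \<otimes> y) = 1"
    by (rule d1; use arcs f_vals in simp)+
  have dn: "?d y (x \<otimes> x) = real n"
    using lip[of y "x \<otimes> x"] f_vals digraph_dist_le[OF walk] by simp
  have neq: "x \<otimes> y \<noteq> x" "x \<otimes> x \<noteq> x" "x \<otimes> y \<noteq> x \<otimes> x"
    using assms(3-5) x y by auto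
  define \<sigma> where "\<sigma> u = (if u = \<one> then x else if u = x then x \<otimes> y else x \<otimes> x)" for u
  have \<sigma>: "\<sigma> \<one> = x" "\<sigma> x = x \<otimes> y" "\<sigma> y = x \<otimes> x"
    using assms(3-5) by (auto simp: \<sigma>_def)
  have bij: "bij_betw \<sigma> ?S ?T"
    using \<sigma> neq assms(3-5) by (auto simp: bij_betw_def inj_on_def)
  have W: "wasserstein ?V ?E (lazy_measure ?E \<alpha> \<one>) (lazy_measure ?E \<alpha> x)
      = \<alpha> + (1 - \<alpha>) / 2 + (1 - \<alpha>) / 2 * real n" if \<alpha>: "0 < \<alpha>" "\<alpha> < 1" for \<alpha>
  proof -
    have nbrs: "out_nbrs ?E \<one> = {x, y}" "out_nbrs ?E x = {x \<otimes> x, x \<otimes> y}"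
      using x y by (simp_all add: out_nbrs_cayley_arcs S)
    have mem: "(u, v) \<in> ?E \<longleftrightarrow> v \<in> out_nbrs ?E u" for u v
      by (simp add: out_nbrs_def)
    have \<mu>: "lazy_measure ?E \<alpha> \<one> u =
          (if u = \<one> then \<alpha> else if u = x \<or> u = y then (1 - \<alpha>) / 2 else 0)"
      and \<nu>: "lazy_measure ?E \<alpha> x u =
          (if u = x then \<alpha> else if u = x \<otimes> x \<or> u = x \<otimes> y then (1 - \<alpha>) / 2 else 0)" for u
      using assms(5) neq by (simp_all add: lazy_measure_def mem nbrs)
    have "wasserstein ?V ?E (lazy_measure ?E \<alpha> \<one>) (lazy_measure ?E \<alpha> x)
        = (\<Sum>u\<in>?S. lazy_measure ?E \<alpha> \<one> u * (f u - f (\<sigma> u)))"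
    proof (rule wasserstein_bij[OF _ _ _ bij, where f = f])
      show "f u - f v \<le> ?d u v" if "u \<in> ?S" "v \<in> ?T" for u v
        using lip that by blast
      show "?d u (\<sigma> u) = f u - f (\<sigma> u)" if "u \<in> ?S" for u
        using that dx dxy dn f_vals by (auto simp: \<sigma>)
      show "lazy_measure ?E \<alpha> x (\<sigma> u) = lazy_measure ?E \<alpha> \<one> u" if "u \<in> ?S" for u
        using that neq assms(3-5) by (auto simp: \<mu> \<nu> \<sigma>)
    qed (use x y \<alpha> in \<open>auto simp: \<mu> \<nu>\<close>)
    also have "\<dots> = \<alpha> + (1 - \<alpha>) / 2 + (1 - \<alpha>) / 2 * real n"
      using assms(3-5) f_vals by (simp add: \<mu> \<sigma>)
    finally show ?thesis .
  qed
  \<comment> \<open>For \<open>0 < \<alpha> < 1\<close> the quotient does not depend on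
    \<open>\<alpha>\<close>, so the limit is that of a constant.\<close>
  have "\<forall>\<^sub>F \<alpha> in at_left 1. \<alpha> \<in> {0<..<1::real}"
    by (rule eventually_at_leftI[of 0]) auto
  then have "\<forall>\<^sub>F \<alpha> in at_left 1. lazy_curvature ?V ?E \<alpha> \<one> x / (1 - \<alpha>) = (1 - real n) / 2"
  proof (rule eventually_mono)
    fix \<alpha> :: real
    assume "\<alpha> \<in> {0<..<1}"
    then show "lazy_curvature ?V ?E \<alpha> \<one> x / (1 - \<alpha>) = (1 - real n) / 2"
      using W[of \<alpha>] dx by (simp add: lazy_curvature_def field_simps)
  qed
  then show ?thesis
    unfolding has_LLY_curvature_def by (rule tendsto_eventually)
qed

section \<open>The generalized quaternion group\<close>

text \<open>Universal property of a presentation: if the letters act on \<open>Z\<close> by mutually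
  inverse maps that satisfy the relations, then equivalent words act alike.\<close>

lemma pres_eq_fold:
  assumes maps: "\<And>p z. z \<in> Z \<Longrightarrow> act p z \<in> Z"
    and cancel: "\<And>g s z. z \<in> Z \<Longrightarrow> act (g, \<not> s) (act (g, s) z) = z"
    and rel: "\<And>u v z. (u, v) \<in> R \<Longrightarrow> z \<in> Z \<Longrightarrow> fold act u z = fold act v z"
  shows "pres_eq R u v \<Longrightarrow> z \<in> Z \<Longrightarrow> fold act u z = fold act v z"
proof (induction arbitrary: z rule: pres_eq.induct)
  case (append u u' v v')
  have "fold act w z \<in> Z" if "z \<in> Z" for w z
    using that by (induction w arbitrary: z) (auto intro: maps)
  with append show ?case by simp
qed (simp_all add: cancel rel)

text \<open>The state \<open>(i, s)\<close> with \<open>0 \<le> i < 2 * m\<close> stands for the element \<open>a\<^sup>i b\<^sup>s\<close>, on which the letters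
  act by multiplication from the right.\<close>

fun quat_act :: "nat \<Rightarrow> quat_gen \<times> bool \<Rightarrow> int \<times> bool \<Rightarrow> int \<times> bool" where
  "quat_act m (GenA, e) (i, s) = ((if e = s then i + 1 else i - 1) mod (2 * int m), s)"
| "quat_act m (GenB, e) (i, s) = ((if e = s then i else i + int m) mod (2 * int m), \<not> s)"

definition quat_states :: "nat \<Rightarrow> (int \<times> bool) set" where
  "quat_states m = {0..<2 * int m} \<times> UNIV"

lemma quat_act_in_states: "0 < m \<Longrightarrow> quat_act m p z \<in> quat_states m"
  by (induction m p z rule: quat_act.induct) (auto simp: quat_states_def)

lemma quat_act_GenA_funpow:
  assumes "0 \<le> i" "i < 2 * int m"
  shows "(quat_act m (GenA, False) ^^ k) (i, s)
    = ((if s then i - int k else i + int k) mod (2 * int m), s)"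
  using assms by (induction k) (auto simp: mod_simps algebra_simps)

text \<open>The three relations are checked on an arbitrary state. This is how elements of the
  presented group are told apart: different resulting states mean inequivalent words.\<close>

lemma quat_act_pres_eq:
  assumes "0 < m" "pres_eq (quat_relations m) u v" "z \<in> quat_states m"
  shows "fold (quat_act m) u z = fold (quat_act m) v z"
proof (rule pres_eq_fold[OF _ _ _ assms(2,3)])
  show "quat_act m (g, \<not> s) (quat_act m (g, s) z) = z" if "z \<in> quat_states m" for g s z
    using that by (cases g; cases z) (auto simp: quat_states_def mod_simps)
  show "fold (quat_act m) u z = fold (quat_act m) v z"
    if "(u, v) \<in> quat_relations m" "z \<in> quat_states m" for u v z
  proof -
    obtain i s where z: "z = (i, s)" by (cases z)
    have i: "0 \<le> i" "i < 2 * int m" using that(2) by (auto simp: z quat_states_def)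
    \<comment> \<open>The first congruence is needed for \<open>b^-1 a b = a^-1\<close> at
      \<open>s = False\<close>, the second for \<open>b^2 = a^m\<close> at
      \<open>s = True\<close>.\<close>
    have "(i + int m * 2 - 1) mod (2 * int m) = (i - 1) mod (2 * int m)"
      using mod_add_self2[of "i - 1" "2 * int m"] by (simp add: algebra_simps)
    moreover have "(i - int m) mod (2 * int m) = (i + int m) mod (2 * int m)"
      using mod_add_self2[of "i - int m" "2 * int m"] by (simp add: algebra_simps)
    ultimately show ?thesis
      using that(1) i
      by (cases s) (auto simp: z quat_relations_def quat_act_GenA_funpow mod_simps
        algebra_simps simp del: quat_act.simps(1), auto simp: mod_simps algebra_simps)
  qed
qed (use assms(1) in \<open>rule quat_act_in_states\<close>)

text \<open>If \<open>z\<close> is the normal form of \<open>g\<close>, the result is the normal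
  form of \<open>g\<close> times \<open>X\<close>. The chosen representative is immaterial by
  \<open>quat_act_pres_eq\<close>.\<close>

definition quat_eval :: "nat \<Rightarrow> int \<times> bool \<Rightarrow> quat_gen word set \<Rightarrow> int \<times> bool" where
  "quat_eval m z X = fold (quat_act m) (SOME w. w \<in> X) z"

lemma quat_eval_pres_class:
  assumes "0 < m" "z \<in> quat_states m"
  shows "quat_eval m z (pres_class (quat_relations m) w) = fold (quat_act m) w z"
proof -
  let ?X = "pres_class (quat_relations m) w"
  have "w \<in> ?X" by (simp add: pres_class_def pres_eq.refl)
  then have "(SOME w. w \<in> ?X) \<in> ?X" by (rule someI)
  then have "pres_eq (quat_relations m) w (SOME w. w \<in> ?X)"
    by (simp add: pres_class_def)
  then show ?thesis
    using assms unfolding quat_eval_def by (metis quat_act_pres_eq)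
qed

text \<open>The distance from \<open>a\<^sup>i b\<^sup>s\<close> to the set \<open>{a, b}\<close>.\<close>

fun gens_dist :: "nat \<Rightarrow> int \<times> bool \<Rightarrow> int" where
  "gens_dist m (i, False) =
     (if i = 1 then 0
      else min (i + 1) (min (2 * int m - i + 1) (\<bar>i - 1 - int m\<bar> + 2)))"
| "gens_dist m (i, True) = min i (min (\<bar>i - 1 - int m\<bar> + 1) (2 * int m + 4 - i))"

text \<open>The entries of the minima are lengths of walks to a generator. From \<open>a^i\<close>
  these are \<open>b a^i\<close>, \<open>a^(2m+1-i)\<close> and a walk with two letters
  \<open>b\<close> and \<open>\<bar>i - 1 - m\<bar>\<close> letters \<open>a\<close>; from
  \<open>a^i b\<close> they are \<open>a^i\<close>, a walk with one letter \<open>b\<close> and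
  \<open>\<bar>i - 1 - m\<bar>\<close> letters \<open>a\<close>, and
  \<open>b^3 a^(2m+1-i)\<close>.\<close>

lemma gens_dist_quat_act:
  assumes "2 \<le> m" "z \<in> quat_states m"
  shows "gens_dist m z \<le> gens_dist m (quat_act m (g, False) z) + 1"
proof -
  obtain i s where z: "z = (i, s)" by (cases z)
  have i: "0 \<le> i" "i < 2 * int m" using assms by (auto simp: z quat_states_def)
  have "(i + int m) mod (2 * int m) = (i - int m) mod (2 * int m)"
    using mod_add_self2[of "i - int m" "2 * int m"] by (simp add: algebra_simps)
  \<comment> \<open>An exponent wraps around at most once per letter, so the reductions turn into
    case distinctions for linear arithmetic.\<close>
  then have mods: "(i + 1) mod (2 * int m) = (if i + 1 = 2 * int m then 0 else i + 1)"
    "(i - 1) mod (2 * int m) = (if i = 0 then 2 * int m - 1 else i - 1)"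
    "(i + int m) mod (2 * int m) = (if i < int m then i + int m else i - int m)"
    "i mod (2 * int m) = i"
    using i by (auto simp: mod_pos_pos_trivial zmod_minus1)
  show ?thesis
    using i assms(1) by (cases g; cases s) (auto simp: z mods min_def abs_if)
qed

section \<open>Relations and explicit walks in the group\<close>

lemma group_gen_quaternion: "group (gen_quaternion m)"
  unfolding gen_quaternion_def by (rule group_presented_group)

lemma carrier_gen_quaternion:
  "carrier (gen_quaternion m) = range (pres_class (quat_relations m))"
  by (simp add: gen_quaternion_def presented_group_def)

lemma one_gen_quaternion: "\<one>\<^bsub>gen_quaternion m\<^esub> = pres_class (quat_relations m) []"
  by (simp add: gen_quaternion_def presented_group_def)

lemma mult_gen_quaternion:
  "pres_class (quat_relations m) u \<otimes>\<^bsub>gen_quaternion m\<^esub> pres_class (quat_relations m) v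
    = pres_class (quat_relations m) (u @ v)"
  by (simp add: gen_quaternion_def mult_pres_class)

lemma quat_gens_in_carrier:
  "quat_a m \<in> carrier (gen_quaternion m)" "quat_b m \<in> carrier (gen_quaternion m)"
  by (simp_all add: quat_a_def quat_b_def carrier_gen_quaternion)

lemma quat_a_pow:
  "quat_a m [^]\<^bsub>gen_quaternion m\<^esub> (k::nat)
    = pres_class (quat_relations m) (replicate k (GenA, False))"
proof -
  interpret group "gen_quaternion m" by (rule group_gen_quaternion)
  show ?thesis
    by (induction k)
      (simp_all add: one_gen_quaternion quat_a_def mult_gen_quaternion replicate_append_same)
qed

text \<open>The conjugation relation is put into the inverse-free form \<open>a b a = b\<close>,
  since walks use positive letters only. It follows from \<open>b^-1 a b = a^-1\<close> by
  multiplying with \<open>b\<close> on the left and \<open>a\<close> on the right.\<close>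

lemma gen_quaternion_relations:
  fixes m :: nat
  defines "Q \<equiv> gen_quaternion m"
  shows "quat_a m [^]\<^bsub>Q\<^esub> (2 * m) = \<one>\<^bsub>Q\<^esub>"
    and "quat_b m \<otimes>\<^bsub>Q\<^esub> quat_b m = quat_a m [^]\<^bsub>Q\<^esub> m"
    and "quat_a m \<otimes>\<^bsub>Q\<^esub> quat_b m \<otimes>\<^bsub>Q\<^esub> quat_a m = quat_b m"
proof -
  interpret group Q unfolding Q_def by (rule group_gen_quaternion)
  let ?R = "quat_relations m"
  let ?A = "pres_class ?R [(GenA, True)]" and ?B = "pres_class ?R [(GenB, True)]"
  note [simp] = quat_gens_in_carrier[of m, folded Q_def]
  have [simp]: "?A \<in> carrier Q" "?B \<in> carrier Q"
    by (simp_all add: Q_def carrier_gen_quaternion)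
  have rel: "pres_class ?R u = pres_class ?R v" if "(u, v) \<in> ?R" for u v
    using that by (simp add: pres_class_eq_iff pres_eq.relation)
  show "quat_a m [^]\<^bsub>Q\<^esub> (2 * m) = \<one>\<^bsub>Q\<^esub>"
    unfolding Q_def quat_a_pow one_gen_quaternion by (rule rel) (simp add: quat_relations_def)
  show "quat_b m \<otimes>\<^bsub>Q\<^esub> quat_b m = quat_a m [^]\<^bsub>Q\<^esub> m"
    unfolding Q_def quat_a_pow unfolding quat_b_def mult_gen_quaternion
    by (rule rel) (simp add: quat_relations_def)
  have "?B \<otimes>\<^bsub>Q\<^esub> quat_a m \<otimes>\<^bsub>Q\<^esub> quat_b m = ?A"
    unfolding Q_def quat_a_def quat_b_def mult_gen_quaternion
    by (rule rel) (simp add: quat_relations_def)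
  moreover have "quat_b m \<otimes>\<^bsub>Q\<^esub> ?B = \<one>\<^bsub>Q\<^esub>" "?A \<otimes>\<^bsub>Q\<^esub> quat_a m = \<one>\<^bsub>Q\<^esub>"
    using pres_eq.cancel[of ?R GenB False] pres_eq.cancel[of ?R GenA True]
    by (simp_all add: Q_def quat_a_def quat_b_def mult_gen_quaternion one_gen_quaternion
      pres_class_eq_iff)
  ultimately show "quat_a m \<otimes>\<^bsub>Q\<^esub> quat_b m \<otimes>\<^bsub>Q\<^esub> quat_a m = quat_b m"
    by (metis \<open>?A \<in> carrier Q\<close> \<open>?B \<in> carrier Q\<close> \<open>quat_a m \<in> _\<close> \<open>quat_b m \<in> _\<close>
      inv_equality inv_solve_left l_one m_assoc m_closed r_one)
qed

text \<open>Induction from the inside: the innermost \<open>a b a\<close> collapses to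
  \<open>b\<close>.\<close>

lemma (in group) pow_mult_pow_eq:
  assumes "a \<in> carrier G" "b \<in> carrier G" "a \<otimes> b \<otimes> a = b"
  shows "a [^] (k::nat) \<otimes> b \<otimes> a [^] k = b"
proof (induction k)
  case (Suc k)
  have "a [^] Suc k \<otimes> b \<otimes> a [^] Suc k = a [^] k \<otimes> a \<otimes> b \<otimes> (a \<otimes> a [^] k)"
    using assms(1) nat_pow_Suc2[of a k] by simp
  also have "\<dots> = a [^] k \<otimes> (a \<otimes> b \<otimes> a) \<otimes> a [^] k"
    using assms(1,2) by (simp add: m_assoc)
  finally have "a [^] Suc k \<otimes> b \<otimes> a [^] Suc k = a [^] k \<otimes> (a \<otimes> b \<otimes> a) \<otimes> a [^] k" .
  with Suc assms show ?case by simp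
qed (use assms in simp)

text \<open>From \<open>b\<close> to \<open>a^2\<close> lead the words \<open>a^(m-2) b\<close> and
  \<open>b^3 a^2\<close>, from \<open>a\<close> to \<open>b^2\<close> the words
  \<open>a^(m-1)\<close> and \<open>b a b\<close>. The last two claims, from
  \<open>a^(2m) = b^4 = e\<close>, supply reachability.\<close>

lemma quat_walks:
  fixes m :: nat
  assumes "2 \<le> m"
  defines "Q \<equiv> gen_quaternion m"
  defines "E \<equiv> cayley_arcs Q {quat_a m, quat_b m}"
  shows "(quat_b m, quat_a m \<otimes>\<^bsub>Q\<^esub> quat_a m) \<in> E ^^ min (m - 1) 5"
    and "(quat_a m, quat_b m \<otimes>\<^bsub>Q\<^esub> quat_b m) \<in> E ^^ min (m - 1) 3"
    and "(quat_a m \<otimes>\<^bsub>Q\<^esub> quat_a m, quat_a m) \<in> E\<^sup>*"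
    and "(quat_b m \<otimes>\<^bsub>Q\<^esub> quat_b m, quat_b m) \<in> E\<^sup>*"
proof -
  interpret group Q unfolding Q_def by (rule group_gen_quaternion)
  define a where "a = quat_a m"
  define b where "b = quat_b m"
  have [simp]: "a \<in> carrier Q" "b \<in> carrier Q"
    using quat_gens_in_carrier by (auto simp: a_def b_def Q_def)
  have rel: "a [^]\<^bsub>Q\<^esub> (2 * m) = \<one>\<^bsub>Q\<^esub>" "b \<otimes>\<^bsub>Q\<^esub> b = a [^]\<^bsub>Q\<^esub> m"
    "a \<otimes>\<^bsub>Q\<^esub> b \<otimes>\<^bsub>Q\<^esub> a = b"
    using gen_quaternion_relations[of m] by (auto simp: a_def b_def Q_def)
  have stepa: "(g, g \<otimes>\<^bsub>Q\<^esub> a) \<in> E" and stepb: "(g, g \<otimes>\<^bsub>Q\<^esub> b) \<in> E" if "g \<in> carrier Q" for g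
    using that by (auto simp: E_def a_def b_def intro: cayley_step)
  have powa: "(g, g \<otimes>\<^bsub>Q\<^esub> a [^]\<^bsub>Q\<^esub> k) \<in> E ^^ k"
    and powb: "(g, g \<otimes>\<^bsub>Q\<^esub> b [^]\<^bsub>Q\<^esub> k) \<in> E ^^ k"
    if "g \<in> carrier Q" for g and k :: nat
    using that unfolding E_def a_def[symmetric] b_def[symmetric]
    by (simp_all add: cayley_walk_power)
  have am: "a [^]\<^bsub>Q\<^esub> m = a [^]\<^bsub>Q\<^esub> (m - 2) \<otimes>\<^bsub>Q\<^esub> (a \<otimes>\<^bsub>Q\<^esub> a)"
    "a [^]\<^bsub>Q\<^esub> m = a \<otimes>\<^bsub>Q\<^esub> a [^]\<^bsub>Q\<^esub> (m - 1)"
  proof -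
    obtain k where k: "m = Suc (Suc k)" using le_Suc_ex[OF assms(1)] by auto
    show "a [^]\<^bsub>Q\<^esub> m = a [^]\<^bsub>Q\<^esub> (m - 2) \<otimes>\<^bsub>Q\<^esub> (a \<otimes>\<^bsub>Q\<^esub> a)" by (simp add: k m_assoc)
    have "a [^]\<^bsub>Q\<^esub> Suc (Suc k) = a \<otimes>\<^bsub>Q\<^esub> a [^]\<^bsub>Q\<^esub> Suc k" by (rule nat_pow_Suc2) simp
    then show "a [^]\<^bsub>Q\<^esub> m = a \<otimes>\<^bsub>Q\<^esub> a [^]\<^bsub>Q\<^esub> (m - 1)" by (simp add: k)
  qed
  have amm: "a [^]\<^bsub>Q\<^esub> m \<otimes>\<^bsub>Q\<^esub> a [^]\<^bsub>Q\<^esub> m = \<one>\<^bsub>Q\<^esub>"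
    using rel(1) by (simp add: nat_pow_mult mult_2)
  \<comment> \<open>Here \<open>a^(m-2) b a^(m-2) b = b b = a^m = a^(m-2) a a\<close>; cancelling
    \<open>a^(m-2)\<close> on the left gives \<open>bab\<close>.\<close>
  have "a [^]\<^bsub>Q\<^esub> (m - 2) \<otimes>\<^bsub>Q\<^esub> (b \<otimes>\<^bsub>Q\<^esub> a [^]\<^bsub>Q\<^esub> (m - 2) \<otimes>\<^bsub>Q\<^esub> b)
      = a [^]\<^bsub>Q\<^esub> (m - 2) \<otimes>\<^bsub>Q\<^esub> b \<otimes>\<^bsub>Q\<^esub> a [^]\<^bsub>Q\<^esub> (m - 2) \<otimes>\<^bsub>Q\<^esub> b"
    by (simp add: m_assoc)
  also have "\<dots> = a [^]\<^bsub>Q\<^esub> (m - 2) \<otimes>\<^bsub>Q\<^esub> (a \<otimes>\<^bsub>Q\<^esub> a)"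
    using rel am(1) by (simp add: pow_mult_pow_eq)
  finally have bab: "b \<otimes>\<^bsub>Q\<^esub> a [^]\<^bsub>Q\<^esub> (m - 2) \<otimes>\<^bsub>Q\<^esub> b = a \<otimes>\<^bsub>Q\<^esub> a"
    by simp
  have "(b, b \<otimes>\<^bsub>Q\<^esub> a [^]\<^bsub>Q\<^esub> (m - 2) \<otimes>\<^bsub>Q\<^esub> b) \<in> E ^^ Suc (m - 2)"
    by (intro relpow_Suc_I[OF powa stepb]) auto
  then have long_a: "(b, a \<otimes>\<^bsub>Q\<^esub> a) \<in> E ^^ (m - 1)"
    unfolding bab Suc_diff_le[OF assms(1), symmetric] by simp
  \<comment> \<open>The walk of length 5 passes through the identity: three steps from
    \<open>b\<close>, because \<open>b^4 = a^(2m) = e\<close>, then two steps to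
    \<open>a^2\<close>.\<close>
  have "b \<otimes>\<^bsub>Q\<^esub> b [^]\<^bsub>Q\<^esub> (3::nat) = (b \<otimes>\<^bsub>Q\<^esub> b) \<otimes>\<^bsub>Q\<^esub> (b \<otimes>\<^bsub>Q\<^esub> b)"
    by (simp add: numeral_3_eq_3 m_assoc)
  then have b3: "b \<otimes>\<^bsub>Q\<^esub> b [^]\<^bsub>Q\<^esub> (3::nat) = \<one>\<^bsub>Q\<^esub>"
    using amm by (simp only: rel(2))
  have "(b, \<one>\<^bsub>Q\<^esub>) \<in> E ^^ 3"
    using powb[of b 3] by (simp add: b3)
  moreover have "(\<one>\<^bsub>Q\<^esub>, a \<otimes>\<^bsub>Q\<^esub> a) \<in> E ^^ Suc (Suc 0)"
    using powa[of "\<one>\<^bsub>Q\<^esub>" "Suc (Suc 0)"] by (simp del: relpow.simps)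
  ultimately have "(b, a \<otimes>\<^bsub>Q\<^esub> a) \<in> E ^^ (3 + Suc (Suc 0))"
    by (rule relpow_trans)
  then have short_a: "(b, a \<otimes>\<^bsub>Q\<^esub> a) \<in> E ^^ 5"
    by (simp del: relpow.simps)
  show "(quat_b m, quat_a m \<otimes>\<^bsub>Q\<^esub> quat_a m) \<in> E ^^ min (m - 1) 5"
    using long_a short_a by (simp add: min_def a_def b_def)
  have long_b: "(a, b \<otimes>\<^bsub>Q\<^esub> b) \<in> E ^^ (m - 1)"
    using powa[of a "m - 1"] am(2) rel(2) by simp
  \<comment> \<open>The end point is \<open>(a b a) b = b b\<close>.\<close>
  have "(a, a \<otimes>\<^bsub>Q\<^esub> b \<otimes>\<^bsub>Q\<^esub> a \<otimes>\<^bsub>Q\<^esub> b) \<in> E ^^ Suc (Suc (Suc 0))"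
    by (intro relpow_Suc_I[OF relpow_Suc_I[OF relpow_Suc_I[OF relpow_0_I stepb] stepa] stepb]) auto
  then have short_b: "(a, b \<otimes>\<^bsub>Q\<^esub> b) \<in> E ^^ 3"
    using rel(3) by (simp add: numeral_3_eq_3 del: relpow.simps)
  show "(quat_a m, quat_b m \<otimes>\<^bsub>Q\<^esub> quat_b m) \<in> E ^^ min (m - 1) 3"
    using long_b short_b by (simp add: min_def a_def b_def)
  have "a \<otimes>\<^bsub>Q\<^esub> a [^]\<^bsub>Q\<^esub> (2 * m - 1) = \<one>\<^bsub>Q\<^esub>"
    using rel(1) assms(1) nat_pow_Suc2[of a "2 * m - 1"] by simp
  then have "(a \<otimes>\<^bsub>Q\<^esub> a, a) \<in> E ^^ (2 * m - 1)"
    using powa[of "a \<otimes>\<^bsub>Q\<^esub> a" "2 * m - 1"] by (simp add: m_assoc)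
  then show "(quat_a m \<otimes>\<^bsub>Q\<^esub> quat_a m, quat_a m) \<in> E\<^sup>*"
    unfolding a_def by (rule relpow_imp_rtrancl)
  have "(b \<otimes>\<^bsub>Q\<^esub> b, b) \<in> E ^^ 3"
    using powb[of "b \<otimes>\<^bsub>Q\<^esub> b" 3] b3 by (simp add: m_assoc)
  then show "(quat_b m \<otimes>\<^bsub>Q\<^esub> quat_b m, quat_b m) \<in> E\<^sup>*"
    unfolding b_def by (rule relpow_imp_rtrancl)
qed

section \<open>Evaluation of the potential and the curvatures\<close>

text \<open>The three elements move the state of the identity to three different states.\<close>

lemma quat_gens_distinct:
  assumes "2 \<le> m"
  shows "quat_a m \<noteq> \<one>\<^bsub>gen_quaternion m\<^esub>" "quat_b m \<noteq> \<one>\<^bsub>gen_quaternion m\<^esub>"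
    "quat_a m \<noteq> quat_b m"
proof -
  have "(0, False) \<in> quat_states m" using assms by (simp add: quat_states_def)
  then have "quat_eval m (0, False) \<one>\<^bsub>gen_quaternion m\<^esub> = (0, False)"
    "quat_eval m (0, False) (quat_a m) = (1, False)"
    "quat_eval m (0, False) (quat_b m) = (0, True)"
    using assms
    by (simp_all add: one_gen_quaternion quat_a_def quat_b_def quat_eval_pres_class)
  then show "quat_a m \<noteq> \<one>\<^bsub>gen_quaternion m\<^esub>" "quat_b m \<noteq> \<one>\<^bsub>gen_quaternion m\<^esub>"
    "quat_a m \<noteq> quat_b m" by auto
qed

text \<open>Evaluating from the state of \<open>x\<^sup>-\<^sup>1\<close> turns the distance to \<open>{a, b}\<close> into the distance to
  \<open>{x a, x b}\<close>.\<close>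

definition quat_potential :: "nat \<Rightarrow> quat_gen \<Rightarrow> quat_gen word set \<Rightarrow> real" where
  "quat_potential m x X
    = real_of_int (gens_dist m (quat_eval m (quat_act m (x, True) (0, False)) X)) - 1"

lemma quat_potential_pres_class:
  assumes "0 < m"
  shows "quat_potential m x (pres_class (quat_relations m) w)
    = real_of_int (gens_dist m (fold (quat_act m) ((x, True) # w) (0, False))) - 1"
  using assms by (simp add: quat_potential_def quat_eval_pres_class quat_act_in_states)

text \<open>An arc appends one positive letter on the right, while the shift by the inverse of
  \<open>x\<close> sits on the left; hence the arc is a single step of the action and
  \<open>gens_dist_quat_act\<close> applies.\<close>

lemma quat_potential_arc:
  assumes m: "2 \<le> m" and "(X, Y) \<in> cayley_arcs (gen_quaternion m) {quat_a m, quat_b m}"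
  shows "quat_potential m x X \<le> quat_potential m x Y + 1"
proof -
  obtain w g where X: "X = pres_class (quat_relations m) w"
    and Y: "Y = pres_class (quat_relations m) (w @ [(g, False)])"
    using assms(2)
    by (auto simp: cayley_arcs_def carrier_gen_quaternion quat_a_def quat_b_def mult_gen_quaternion)
  have "fold (quat_act m) w z \<in> quat_states m" if "z \<in> quat_states m" for z
    using that m by (induction w arbitrary: z) (simp_all add: quat_act_in_states)
  then have "fold (quat_act m) ((x, True) # w) (0, False) \<in> quat_states m"
    using m by (simp add: quat_act_in_states)
  from gens_dist_quat_act[OF m this, of g] show ?thesis
    using m by (simp add: X Y quat_potential_pres_class)
qed

text \<open>The two values depending on \<open>m\<close> come from
  \<open>a^-1 b = a^(2m-1) b\<close> and \<open>b^-1 a = a^(m-1) b\<close>, where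
  \<open>gens_dist\<close> is the minimum of \<open>2m-1\<close>, \<open>m-1\<close>,
  \<open>5\<close> and of \<open>m-1\<close>, \<open>3\<close>, \<open>m+5\<close>
  respectively.\<close>

lemma quat_potential_values:
  fixes m :: nat
  assumes "2 \<le> m"
  defines "Q \<equiv> gen_quaternion m" and "a \<equiv> quat_a m" and "b \<equiv> quat_b m"
  shows "quat_potential m GenA \<one>\<^bsub>Q\<^esub> = 1" "quat_potential m GenA a = 0"
    "quat_potential m GenA (a \<otimes>\<^bsub>Q\<^esub> a) = - 1" "quat_potential m GenA (a \<otimes>\<^bsub>Q\<^esub> b) = - 1"
    "quat_potential m GenA b = real (min (m - 1) 5) - 1"
    "quat_potential m GenB \<one>\<^bsub>Q\<^esub> = 1" "quat_potential m GenB b = 0"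
    "quat_potential m GenB (b \<otimes>\<^bsub>Q\<^esub> b) = - 1" "quat_potential m GenB (b \<otimes>\<^bsub>Q\<^esub> a) = - 1"
    "quat_potential m GenB a = real (min (m - 1) 3) - 1"
proof -
  have mods: "- 1 mod (2 * int m) = 2 * int m - 1" "1 mod (2 * int m) = 1"
    "int m mod (2 * int m) = int m" "(int m - 1) mod (2 * int m) = int m - 1"
    using assms(1) by (auto simp: zmod_minus1 mod_pos_pos_trivial)
  note defs = Q_def a_def b_def quat_a_def quat_b_def one_gen_quaternion mult_gen_quaternion
    quat_potential_pres_class
  show "quat_potential m GenA \<one>\<^bsub>Q\<^esub> = 1" "quat_potential m GenA a = 0"
    "quat_potential m GenA (a \<otimes>\<^bsub>Q\<^esub> a) = - 1" "quat_potential m GenA (a \<otimes>\<^bsub>Q\<^esub> b) = - 1"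
    "quat_potential m GenA b = real (min (m - 1) 5) - 1"
    "quat_potential m GenB \<one>\<^bsub>Q\<^esub> = 1" "quat_potential m GenB b = 0"
    "quat_potential m GenB (b \<otimes>\<^bsub>Q\<^esub> b) = - 1" "quat_potential m GenB (b \<otimes>\<^bsub>Q\<^esub> a) = - 1"
    "quat_potential m GenB a = real (min (m - 1) 3) - 1"
    using assms(1) by (auto simp: defs mods min_def)
qed

theorem proposition4p2:
  fixes m :: nat
  assumes "2 \<le> m"
  defines "Q \<equiv> gen_quaternion m"
  defines "E \<equiv> cayley_arcs Q {quat_a m, quat_b m}"
  shows
    "has_LLY_curvature (carrier Q) E \<one>\<^bsub>Q\<^esub> (quat_a m)
       (if m = 2 then 0 else if m = 3 then - 1 / 2 else if m = 4 then - 1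
        else if m = 5 then - 3 / 2 else - 2) \<and>
     has_LLY_curvature (carrier Q) E \<one>\<^bsub>Q\<^esub> (quat_b m)
       (if m = 2 then 0 else if m = 3 then - 1 / 2 else - 1)"
proof -
  interpret group Q unfolding Q_def by (rule group_gen_quaternion)
  note facts = quat_gens_in_carrier quat_gens_distinct[OF assms(1)]
    quat_walks[OF assms(1)] quat_potential_values[OF assms(1)]
  have "has_LLY_curvature (carrier Q) E \<one>\<^bsub>Q\<^esub> (quat_a m) ((1 - real (min (m - 1) 5)) / 2)"
    unfolding E_def
    by (rule LLY_curvature_two_generators[of _ "quat_b m" _ "quat_potential m GenA"])
      (use facts quat_potential_arc[OF assms(1)] in \<open>auto simp: Q_def\<close>)
  moreover have "has_LLY_curvature (carrier Q) E \<one>\<^bsub>Q\<^esub> (quat_b m) ((1 - real (min (m - 1) 3)) / 2)"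
    unfolding E_def
    by (rule LLY_curvature_two_generators[of _ "quat_a m" _ "quat_potential m GenB"])
      (use facts quat_potential_arc[OF assms(1)] in \<open>auto simp: Q_def\<close>)
  \<comment> \<open>The minima become constant from \<open>m = 6\<close> and \<open>m = 4\<close>
    on, which gives the last case of each formula.\<close>
  moreover have "(1 - real (min (m - 1) 5)) / 2
      = (if m = 2 then 0 else if m = 3 then - 1 / 2 else if m = 4 then - 1
        else if m = 5 then - 3 / 2 else - 2)"
    "(1 - real (min (m - 1) 3)) / 2 = (if m = 2 then 0 else if m = 3 then - 1 / 2 else - 1)"
    using assms(1) by (auto simp: min_def)
  ultimately show ?thesis by simp
qed

end
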